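(* Assume (A1)–(A4) as listed in the context, with $h(\xi)=(\xi,\bar h)$ for a fixed $\bar h\in\mathbb{R}^{r-d}$. Let $\sigma_i^2$ denote the (finite) variance of $\xi_i$, $i=1,\ldots,d$, where $\xi$ has distribution $P$. Let $x\in X$, let $$f(\xi)=\max_{j=1,\ldots,\ell}\langle v^{j},(\xi,\bar h)-Tx\rangle\qquad(\xi\in\mathbb{R}^d),$$ and assume $\sigma(f)>0$. Then $$\bar S_{\{i\}}\le\frac{\sigma_i^2}{\sigma^2(f)}\max_{j=1,\ldots,\ell}|v_i^j|^2\qquad(i=1,\ldots,d),$$ $$\bar d_S\le\frac{1}{\sigma^2(f)}\max_{j=1,\ldots,\ell}\|v^j\|_\infty^2\sum_{i=1}^d\sigma_i^2 ,$$ where $v^j$, $j=1,\ldots,\ell$, are the vertices of the dual feasible polyhedron $\mathcal D$.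
   Context: Setting. $X\subseteq\mathbb{R}^m$ is a convex polyhedral set, $T$ is a real $r\times m$ matrix, $W$ a real $r\times\bar m$ matrix, $q\in\mathbb{R}^{\bar m}$, $d\le r$. $P$ is a probability distribution on $\mathbb{R}^d$. The dual feasible set is $\mathcal D=\{z\in\mathbb{R}^r:W^\top z\le q\}$; $v^1,\ldots,v^\ell$ denote its vertices, and $\mathcal D={\rm conv}\{v^1,\ldots,v^\ell\}+\{z\in\mathbb{R}^r:W^\top z\le 0\}$. Assumptions. (A1) $h(\xi)-Tx\in W(\mathbb{R}_+^{\bar m})$ for all $\xi\in\mathbb{R}^d$, $x\in X$ (relatively complete recourse). (A2) $\mathcal D\neq\emptyset$ (dual feasibility). (A3) $\int_{\mathbb{R}^d}\|\xi\|P(d\xi)<\infty$. (A4) $P$ has a density $\rho(\xi)=\prod_{i=1}^d\rho_i(\xi_i)$, where each $\rho_i$ is a continuous probability density on $\mathbb{R}$. ANOVA quantities. Let $D=\{1,\ldots,d\}$. For $k\in D$, $(P_kf)(\xi)=\int_{-\infty}^{\infty}f(\xi_1,\ldots,\xi_{k-1},s,\xi_{k+1},\ldots,\xi_d)\rho_k(s)\,ds$; for $u\subseteq D$, $P_u$ is the composition of the $P_k$, $k\in u$, and $-u=D\setminus u$. The ANOVA terms are $f_u=\sum_{v\subseteq u}(-1)^{|u|-|v|}P_{-v}f$. With $\|g\|_{2,\rho}^2=\int_{\mathbb{R}^d}|g|^2\rho\,d\xi$, set $\sigma^2(f)=\|f-\int f\rho\,d\xi\|_{2,\rho}^2$ and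 $\sigma_u^2(f)=\|f_u\|_{2,\rho}^2$ for $\emptyset\ne u\subseteq D$. The global sensitivity index is $$\bar S_u=\frac{1}{\sigma^2(f)}\sum_{v\subseteq D,\ v\cap u\ne\emptyset}\sigma_v^2(f),$$ and the mean dimension in the superposition sense is $$\bar d_S=\sum_{\emptyset\ne u\subseteq D}|u|\,\frac{\sigma_u^2(f)}{\sigma^2(f)}.$$ *)

theory Defs
  imports "HOL-Probability.Probability"
begin

text \<open>The index set \<open>D = {1, ..., d}\<close> is a nonempty finite linearly ordered type \<open>'d\<close>; the spaces
  of dimension \<open>r\<close>, \<open>m\<close>, \<open>m-bar\<close> are \<open>real^'r\<close>, \<open>real^'m\<close>, \<open>real^'n\<close>. That \<open>\<xi>\<close> occupies \<open>d \<le> r\<close>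
  of the \<open>r\<close> coordinates is expressed by an injection \<open>\<iota> :: 'd \<Rightarrow> 'r\<close>; the case \<open>d = r\<close> is included,
  which a sum type \<open>'d + 'e\<close> would exclude.\<close>

text \<open>The vector \<open>(\<xi>, h-bar)\<close>. Only the values of \<open>hbar\<close> outside \<open>range \<iota>\<close> matter, so \<open>hbar\<close>
  stands for a vector with \<open>r - d\<close> components.\<close>

definition join_vec :: "('d \<Rightarrow> 'r) \<Rightarrow> ('r \<Rightarrow> real) \<Rightarrow> real^'d \<Rightarrow> real^'r" where
  "join_vec \<iota> hbar \<xi> = (\<chi> k. if k \<in> range \<iota> then \<xi> $ (inv \<iota> k) else hbar k)"

definition dual_feasible :: "real^'n^'r \<Rightarrow> real^'n \<Rightarrow> (real^'r) set" where
  "dual_feasible W q = {z. \<forall>j. (transpose W *v z) $ j \<le> q $ j}"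

definition vertices :: "(real^'r) set \<Rightarrow> (real^'r) set" where
  "vertices S = {v. v extreme_point_of S}"

definition recourse_value ::
    "(real^'r) set \<Rightarrow> ('d \<Rightarrow> 'r) \<Rightarrow> ('r \<Rightarrow> real) \<Rightarrow> real^'m^'r \<Rightarrow> real^'m \<Rightarrow> real^'d \<Rightarrow> real" where
  "recourse_value V \<iota> hbar T x \<xi> = (MAX v\<in>V. v \<bullet> (join_vec \<iota> hbar \<xi> - T *v x))"

definition joint_density :: "('d::finite \<Rightarrow> real \<Rightarrow> real) \<Rightarrow> real^'d \<Rightarrow> real" where
  "joint_density \<rho> \<xi> = (\<Prod>i\<in>UNIV. \<rho> i (\<xi> $ i))"

text \<open>Squared weighted norm. The integral is the Bochner integral, hence \<open>0\<close> if \<open>\<bar>g\<bar>\<^sup>2 \<rho>\<close> is not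
  integrable.\<close>

definition sq_norm :: "('d::finite \<Rightarrow> real \<Rightarrow> real) \<Rightarrow> (real^'d \<Rightarrow> real) \<Rightarrow> real" where
  "sq_norm \<rho> g = (\<integral>\<xi>. \<bar>g \<xi>\<bar>\<^sup>2 * joint_density \<rho> \<xi> \<partial>lborel)"

definition proj :: "('d \<Rightarrow> real \<Rightarrow> real) \<Rightarrow> 'd \<Rightarrow> (real^'d \<Rightarrow> real) \<Rightarrow> real^'d \<Rightarrow> real" where
  "proj \<rho> k f \<xi> = (\<integral>s. f (\<chi> i. if i = k then s else \<xi> $ i) * \<rho> k s \<partial>lborel)"

text \<open>The composition \<open>P\<^sub>u\<close> is taken in increasing order of the indices. The order is immaterial
  whenever Fubini's theorem applies, but a fixed one is needed to define \<open>P\<^sub>u\<close> on arbitrary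
  functions.\<close>

definition proj_set ::
    "('d::{finite,linorder} \<Rightarrow> real \<Rightarrow> real) \<Rightarrow> 'd set \<Rightarrow> (real^'d::_ \<Rightarrow> real) \<Rightarrow> real^'d::_ \<Rightarrow> real" where
  "proj_set \<rho> u f = foldr (proj \<rho>) (sorted_list_of_set u) f"

definition anova_term ::
    "('d::{finite,linorder} \<Rightarrow> real \<Rightarrow> real) \<Rightarrow> (real^'d::_ \<Rightarrow> real) \<Rightarrow> 'd set \<Rightarrow> real^'d::_ \<Rightarrow> real" where
  "anova_term \<rho> f u \<xi> = (\<Sum>v\<in>Pow u. (-1) ^ (card u - card v) * proj_set \<rho> (- v) f \<xi>)"

definition sigma2 :: "('d::finite \<Rightarrow> real \<Rightarrow> real) \<Rightarrow> (real^'d \<Rightarrow> real) \<Rightarrow> real" where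
  "sigma2 \<rho> f = sq_norm \<rho> (\<lambda>\<xi>. f \<xi> - (\<integral>\<eta>. f \<eta> * joint_density \<rho> \<eta> \<partial>lborel))"

definition sigma2_term ::
    "('d::{finite,linorder} \<Rightarrow> real \<Rightarrow> real) \<Rightarrow> (real^'d::_ \<Rightarrow> real) \<Rightarrow> 'd set \<Rightarrow> real" where
  "sigma2_term \<rho> f u = sq_norm \<rho> (anova_term \<rho> f u)"

definition global_sensitivity ::
    "('d::{finite,linorder} \<Rightarrow> real \<Rightarrow> real) \<Rightarrow> (real^'d::_ \<Rightarrow> real) \<Rightarrow> 'd set \<Rightarrow> real" where
  "global_sensitivity \<rho> f u = 1 / sigma2 \<rho> f * (\<Sum>v | v \<inter> u \<noteq> {}. sigma2_term \<rho> f v)"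

definition mean_dim_superposition ::
    "('d::{finite,linorder} \<Rightarrow> real \<Rightarrow> real) \<Rightarrow> (real^'d::_ \<Rightarrow> real) \<Rightarrow> real" where
  "mean_dim_superposition \<rho> f =
     (\<Sum>u | u \<noteq> {}. real (card u) * (sigma2_term \<rho> f u / sigma2 \<rho> f))"

end

theory Submission
  imports Defs
begin

text \<open>The maximum \<open>f\<close> of finitely many affine functions is Lipschitz, with constant
  \<open>L\<^sub>i = max\<^sub>j |v\<^sup>j\<^sub>i|\<close> in the \<open>i\<close>-th variable. On square integrable functions the \<open>P\<^sub>k\<close> are commuting
  orthogonal projections, so the ANOVA terms are orthogonal, and those containing \<open>i\<close> add up to
  \<open>f - P\<^sub>i f\<close>; hence \<open>\<Sum>\<^bsub>i\<in>u\<^esub> \<sigma>\<^sub>u\<^sup>2 = \<parallel>f - P\<^sub>i f\<parallel>\<^sup>2\<close>. Since \<open>P\<^sub>i f\<close> is the best approximation of \<open>f\<close>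
  independent of \<open>\<xi>\<^sub>i\<close>, this is at most the squared distance from \<open>f\<close> to \<open>f\<close> with \<open>\<xi>\<^sub>i\<close> frozen
  at its mean, which is at most \<open>L\<^sub>i\<^sup>2 \<sigma>\<^sub>i\<^sup>2\<close>. Summing over \<open>i\<close> counts every \<open>u\<close> exactly \<open>|u|\<close> times
  and gives the bound for the mean dimension.

  Lipschitz functions form a class on which \<open>P\<^sub>k\<close> and the identities between the \<open>P\<^sub>k\<close> make sense
  pointwise, not merely almost everywhere.\<close>

section \<open>Overwriting one coordinate of a vector\<close>

definition upd :: "real^'d \<Rightarrow> 'd \<Rightarrow> real \<Rightarrow> real^'d" where
  "upd \<xi> k s = (\<chi> i. if i = k then s else \<xi> $ i)"

lemma upd_nth [simp]: "upd \<xi> k s $ i = (if i = k then s else \<xi> $ i)"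
  by (simp add: upd_def)

lemma upd_upd [simp]: "upd (upd \<xi> k s) k t = upd \<xi> k t"
  by (simp add: vec_eq_iff)

lemma upd_commute: "j \<noteq> k \<Longrightarrow> upd (upd \<xi> k s) j t = upd (upd \<xi> j t) k s"
  by (simp add: vec_eq_iff)

lemma borel_measurable_vec_lambda:
  fixes f :: "'a \<Rightarrow> real^'d"
  assumes "\<And>i. (\<lambda>x. f x $ i) \<in> borel_measurable M"
  shows "f \<in> borel_measurable M"
  by (subst borel_measurable_euclidean_space) (auto simp: Basis_vec_def inner_axis assms)

lemma borel_measurable_vec_nth [measurable]: "(\<lambda>\<xi>::real^'d. \<xi> $ i) \<in> borel_measurable borel"
  by (intro borel_measurable_continuous_onI continuous_intros)

lemma measurable_upd [measurable]:
  "(\<lambda>(\<xi>, s). upd \<xi> k s) \<in> borel_measurable (borel \<Otimes>\<^sub>M borel)"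
  by (rule borel_measurable_vec_lambda) (auto simp: split_beta')

lemma upd_diff: "upd \<xi> k s - \<xi> = axis k (s - \<xi> $ k)"
  by (simp add: vec_eq_iff axis_def)

lemma norm_axis: "norm (axis k c :: real^'d) = \<bar>c\<bar>"
  by (simp add: norm_eq_sqrt_inner inner_axis_axis)

lemma dist_upd_self [simp]: "dist (upd \<xi> k s) \<xi> = \<bar>s - \<xi> $ k\<bar>"
  by (simp add: dist_norm upd_diff norm_axis)

lemma dist_upd_le: "dist (upd \<xi> k s) (upd \<eta> k s) \<le> dist \<xi> \<eta>"
  unfolding dist_vec_def by (intro L2_set_mono) auto

text \<open>Both measures give a box the product of its side lengths, and \<open>lborel_eqI\<close>
  says that boxes determine \<open>lborel\<close>. This transfers the theory of \<open>PiM\<close>,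
  which lives on functions, to vectors.\<close>

lemma distr_PiM_lborel_vec:
  "distr (PiM UNIV (\<lambda>_::'d::finite. lborel)) borel (\<lambda>\<omega>. \<chi> i. \<omega> i) = (lborel :: (real^'d) measure)"
proof (rule lborel_eqI [symmetric])
  interpret product_sigma_finite "\<lambda>_::'d. lborel :: real measure" ..
  have [measurable]: "(\<lambda>\<omega>. \<chi> i. \<omega> i) \<in> borel_measurable (PiM UNIV (\<lambda>_::'d. lborel :: real measure))"
    by (rule borel_measurable_vec_lambda) simp
  fix l u :: "real^'d"
  assume le: "\<And>b. b \<in> Basis \<Longrightarrow> l \<bullet> b \<le> u \<bullet> b"
  have le': "l $ i \<le> u $ i" for i
    using le[of "axis i 1"] by (simp add: inner_axis axis_in_Basis_iff)
  have "(\<lambda>\<omega>. \<chi> i. \<omega> i) -` box l u \<inter> space (PiM UNIV (\<lambda>_::'d. lborel :: real measure))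
      = PiE UNIV (\<lambda>i. {l $ i <..< u $ i})"
    by (auto simp: space_PiM mem_box_cart PiE_iff)
  then have "emeasure (distr (PiM UNIV (\<lambda>_::'d. lborel)) borel (\<lambda>\<omega>. \<chi> i. \<omega> i)) (box l u)
      = (\<Prod>i\<in>UNIV. ennreal (u $ i - l $ i))"
    by (simp add: emeasure_distr emeasure_PiM le')
  also have "\<dots> = ennreal (\<Prod>i\<in>UNIV. u $ i - l $ i)"
    by (simp add: le' prod_ennreal)
  \<comment> \<open>The basis vectors are the \<open>axis i 1\<close>, so a product over
    \<open>Basis\<close> is a product over indices.\<close>
  also have "(\<Prod>i\<in>UNIV. u $ i - l $ i) = (\<Prod>b\<in>Basis. (u - l) \<bullet> b)"
  proof -
    have "inj (\<lambda>i::'d. axis i (1::real))"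
      by (auto simp: inj_def axis_eq_axis)
    then show ?thesis
      by (simp add: Basis_vec_def UNION_singleton_eq_range prod.reindex inner_axis comp_def)
  qed
  finally show "emeasure (distr (PiM UNIV (\<lambda>_::'d. lborel)) borel (\<lambda>\<omega>. \<chi> i. \<omega> i)) (box l u)
      = ennreal (\<Prod>b\<in>Basis. (u - l) \<bullet> b)" .
qed simp

section \<open>Product densities, their marginals and resampling of one coordinate\<close>

locale product_density =
  fixes \<rho> :: "'d::{finite,linorder} \<Rightarrow> real \<Rightarrow> real"
  assumes rho_measurable [measurable]: "\<rho> i \<in> borel_measurable borel"
    and rho_nonneg [simp]: "0 \<le> \<rho> i s"
    and rho_prob: "(\<integral>\<^sup>+s. ennreal (\<rho> i s) \<partial>lborel) = 1"
    and second_moment: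
      "integrable (density lborel (\<lambda>\<xi>::real^'d::_. ennreal (joint_density \<rho> \<xi>))) (\<lambda>\<xi>. (\<xi> $ i)\<^sup>2)"
begin

definition N :: "'d \<Rightarrow> real measure" where
  "N k = density lborel (\<lambda>s. ennreal (\<rho> k s))"

definition M :: "(real^'d::_) measure" where
  "M = density lborel (\<lambda>\<xi>. ennreal (joint_density \<rho> \<xi>))"

lemma sets_N [simp, measurable_cong]: "sets (N k) = sets borel"
  by (simp add: N_def)

lemma space_N [simp]: "space (N k) = UNIV"
  by (simp add: N_def)

lemma sets_M [simp, measurable_cong]: "sets M = sets borel"
  by (simp add: M_def)

lemma space_M [simp]: "space M = UNIV"
  by (simp add: M_def)

lemma joint_density_measurable [measurable]: "joint_density \<rho> \<in> borel_measurable borel"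
  unfolding joint_density_def by measurable

lemma joint_density_nonneg [simp]: "0 \<le> joint_density \<rho> \<xi>"
  by (simp add: joint_density_def prod_nonneg)

lemma prob_space_N: "prob_space (N k)"
  by (rule prob_spaceI) (simp add: N_def emeasure_density rho_prob)

lemma sigma_finite_N: "sigma_finite_measure (N k)"
  by (simp add: prob_space_imp_sigma_finite prob_space_N)

sublocale N: product_prob_space N UNIV
  by (simp add: product_prob_space_def product_prob_space_axioms_def product_sigma_finite_def
      prob_space_N prob_space_imp_sigma_finite)

lemma vec_measurable [measurable]: "(\<lambda>\<omega>. \<chi> i. \<omega> i) \<in> measurable (PiM UNIV N) borel"
  by (rule borel_measurable_vec_lambda) simp

text \<open>The density is a product of functions of single coordinates, so on boxes its integral
  factors into the masses of the marginals \<open>N i\<close>.\<close>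

lemma M_eq_distr: "M = distr (PiM UNIV N) borel (\<lambda>\<omega>. \<chi> i. \<omega> i)"
proof -
  interpret L: product_sigma_finite "\<lambda>_::'d. lborel :: real measure" ..
  let ?L = "PiM UNIV (\<lambda>_::'d. lborel :: real measure)"
  let ?v = "\<lambda>\<omega>. (\<chi> i. \<omega> i) :: real^'d::_"
  have [measurable]: "?v \<in> borel_measurable ?L"
    by (rule borel_measurable_vec_lambda) simp
  have sets: "sets ?L = sets (PiM UNIV N)"
    by (intro sets_PiM_cong) auto
  have "density ?L (\<lambda>\<omega>. ennreal (joint_density \<rho> (?v \<omega>))) = PiM UNIV N"
  proof (rule N.PiM_eqI)
    fix A assume A: "\<And>i. i \<in> UNIV \<Longrightarrow> A i \<in> sets (N i)"
    then have [measurable]: "A i \<in> sets borel" for i by simp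
    have PiE: "Pi\<^sub>E UNIV A \<in> sets ?L"
      by (intro sets_PiM_I_finite) auto
    \<comment> \<open>The indicator of a box is the product of the indicators of its sides, so the
      whole integrand splits by coordinates.\<close>
    have "ennreal (joint_density \<rho> (?v \<omega>)) * indicator (Pi\<^sub>E UNIV A) \<omega> =
        (\<Prod>i\<in>UNIV. ennreal (\<rho> i (\<omega> i)) * indicator (A i) (\<omega> i))" for \<omega>
      by (auto simp: joint_density_def prod_ennreal prod.distrib indicator_def prod_zero_iff PiE_iff
          prod.If_cases intro!: prod_eq_1_iff[THEN iffD2] split: if_splits)
    then have "emeasure (density ?L (\<lambda>\<omega>. ennreal (joint_density \<rho> (?v \<omega>)))) (Pi\<^sub>E UNIV A)
       = (\<integral>\<^sup>+\<omega>. (\<Prod>i\<in>UNIV. ennreal (\<rho> i (\<omega> i)) * indicator (A i) (\<omega> i)) \<partial>?L)"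
      using PiE by (simp add: emeasure_density)
    also have "\<dots> = (\<Prod>i\<in>UNIV. \<integral>\<^sup>+s. ennreal (\<rho> i s) * indicator (A i) s \<partial>lborel)"
      by (intro L.product_nn_integral_prod) auto
    also have "\<dots> = (\<Prod>i\<in>UNIV. emeasure (N i) (A i))"
      by (simp add: N_def emeasure_density)
    finally show "emeasure (density ?L (\<lambda>\<omega>. ennreal (joint_density \<rho> (?v \<omega>)))) (Pi\<^sub>E UNIV A)
       = (\<Prod>i\<in>UNIV. emeasure (N i) (A i))" .
  qed (simp_all add: sets)
  then have "distr (PiM UNIV N) borel ?v =
      distr (density ?L (\<lambda>\<omega>. ennreal (joint_density \<rho> (?v \<omega>)))) borel ?v"
    by simp
  also have "\<dots> = density (distr ?L borel ?v) (\<lambda>\<xi>. ennreal (joint_density \<rho> \<xi>))"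
    by (rule density_distr [symmetric]) auto
  finally show ?thesis
    by (simp add: M_def distr_PiM_lborel_vec)
qed

sublocale M: prob_space M
  unfolding M_eq_distr by (intro N.prob_space_distr) measurable

text \<open>The coordinates are independent, so replacing the \<open>k\<close>-th by a fresh
  independent draw from \<open>N k\<close> leaves the joint law unchanged. Every later passage
  between \<open>M\<close> and the marginals rests on this fact.\<close>

lemma distr_upd: "distr (M \<Otimes>\<^sub>M N k) borel (\<lambda>(\<xi>, s). upd \<xi> k s) = M"
proof -
  let ?P = "PiM UNIV N" and ?v = "\<lambda>\<omega>. (\<chi> i. \<omega> i) :: real^'d::_"
  have [measurable]: "(\<lambda>(\<omega>, s). fun_upd \<omega> k s) \<in> measurable (?P \<Otimes>\<^sub>M N k) ?P"
    by (rule measurable_PiM_single') (auto simp: space_PiM split_beta')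
  have PiM: "distr (?P \<Otimes>\<^sub>M N k) ?P (\<lambda>(\<omega>, s). fun_upd \<omega> k s) = ?P"
  proof (rule N.PiM_eqI)
    fix A assume A: "\<And>i. i \<in> UNIV \<Longrightarrow> A i \<in> sets (N i)"
    \<comment> \<open>The old \<open>k\<close>-th coordinate is overwritten and hence unconstrained;
      the condition \<open>A k\<close> falls on \<open>s\<close> alone.\<close>
    have "(\<lambda>(\<omega>, s). fun_upd \<omega> k s) -` Pi\<^sub>E UNIV A \<inter> space (?P \<Otimes>\<^sub>M N k)
        = Pi\<^sub>E UNIV (fun_upd A k UNIV) \<times> A k"
      by (auto simp: space_pair_measure space_PiM PiE_iff split: if_splits)
    moreover have "Pi\<^sub>E UNIV A \<in> sets ?P" "Pi\<^sub>E UNIV (fun_upd A k UNIV) \<in> sets ?P"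
      using A by (auto intro!: sets_PiM_I_finite)
    moreover have "emeasure (N k) UNIV = 1"
      using prob_space.emeasure_space_1[OF prob_space_N] by simp
    ultimately show "emeasure (distr (?P \<Otimes>\<^sub>M N k) ?P (\<lambda>(\<omega>, s). fun_upd \<omega> k s)) (Pi\<^sub>E UNIV A)
        = (\<Prod>i\<in>UNIV. emeasure (N i) (A i))"
      using A by (simp add: emeasure_distr sigma_finite_measure.emeasure_pair_measure_Times[OF sigma_finite_N] N.emeasure_PiM
          prod.remove[of UNIV k] mult.commute)
  qed simp_all
  \<comment> \<open>\<open>N k\<close> is written as its image under the identity so that
    \<open>pair_measure_distr\<close> applies to both factors.\<close>
  have "M \<Otimes>\<^sub>M N k = distr ?P borel ?v \<Otimes>\<^sub>M distr (N k) (N k) (\<lambda>s. s)"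
    by (simp add: M_eq_distr)
  also have "\<dots> = distr (?P \<Otimes>\<^sub>M N k) (borel \<Otimes>\<^sub>M N k) (\<lambda>(\<omega>, s). (?v \<omega>, s))"
    by (rule pair_measure_distr) (auto simp: sigma_finite_N)
  finally have "distr (M \<Otimes>\<^sub>M N k) borel (\<lambda>(\<xi>, s). upd \<xi> k s)
      = distr (?P \<Otimes>\<^sub>M N k) borel ((\<lambda>(\<xi>, s). upd \<xi> k s) \<circ> (\<lambda>(\<omega>, s). (?v \<omega>, s)))"
    by (simp add: distr_distr)
  also have "(\<lambda>(\<xi>, s). upd \<xi> k s) \<circ> (\<lambda>(\<omega>, s). (?v \<omega>, s)) = ?v \<circ> (\<lambda>(\<omega>, s). fun_upd \<omega> k s)"
    by (auto simp: fun_eq_iff vec_eq_iff)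
  also have "distr (?P \<Otimes>\<^sub>M N k) borel \<dots> = distr (distr (?P \<Otimes>\<^sub>M N k) ?P (\<lambda>(\<omega>, s). fun_upd \<omega> k s)) borel ?v"
    by (rule distr_distr [symmetric]) measurable
  finally show ?thesis
    by (simp add: PiM M_eq_distr)
qed

text \<open>After resampling, the \<open>k\<close>-th coordinate is the fresh draw itself. This
  carries the first moment of \<open>\<xi> $ k\<close> over to \<open>N k\<close>.\<close>

lemma distr_nth: "distr M borel (\<lambda>\<xi>. \<xi> $ k) = N k"
proof -
  have "distr M borel (\<lambda>\<xi>. \<xi> $ k) = distr (distr (M \<Otimes>\<^sub>M N k) borel (\<lambda>(\<xi>, s). upd \<xi> k s)) borel (\<lambda>\<xi>. \<xi> $ k)"
    by (simp add: distr_upd)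
  also have "\<dots> = distr (M \<Otimes>\<^sub>M N k) borel snd"
    by (subst distr_distr) (auto simp: comp_def split_beta')
  also have "\<dots> = N k"
  proof (rule measure_eqI)
    fix A assume "A \<in> sets (distr (M \<Otimes>\<^sub>M N k) borel snd)"
    then have [measurable]: "A \<in> sets borel" by simp
    have "snd -` A \<inter> space (M \<Otimes>\<^sub>M N k) = UNIV \<times> A"
      by (auto simp: space_pair_measure)
    then show "emeasure (distr (M \<Otimes>\<^sub>M N k) borel snd) A = emeasure (N k) A"
      using M.emeasure_space_1 by (simp add: emeasure_distr sigma_finite_measure.emeasure_pair_measure_Times[OF sigma_finite_N])
  qed simp
  finally show ?thesis .
qed

end

section \<open>The class of real Lipschitz functions\<close>

definition lip :: "('a::metric_space \<Rightarrow> 'b::metric_space) \<Rightarrow> bool" where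
  "lip g \<longleftrightarrow> (\<exists>C. C-lipschitz_on UNIV g)"

lemma lip_add: "lip g \<Longrightarrow> lip h \<Longrightarrow> lip (\<lambda>x. g x + h x :: real)"
  unfolding lip_def by (blast intro: lipschitz_on_add)

lemma lip_diff: "lip g \<Longrightarrow> lip h \<Longrightarrow> lip (\<lambda>x. g x - h x :: real)"
  unfolding lip_def by (blast intro: lipschitz_on_diff)

lemma lip_const: "lip (\<lambda>x. c)"
  unfolding lip_def by (blast intro: lipschitz_on_constant)

lemma lip_cmult: "lip g \<Longrightarrow> lip (\<lambda>x. c * g x :: real)"
  unfolding lip_def by (blast intro: lipschitz_on_cmult_real)

lemma lip_sum: "(\<And>v. v \<in> A \<Longrightarrow> lip (G v)) \<Longrightarrow> lip (\<lambda>x. \<Sum>v\<in>A. G v x :: real)"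
  by (induction A rule: infinite_finite_induct) (simp_all add: lip_const lip_add)

lemma lipE:
  assumes "lip (g :: 'a::metric_space \<Rightarrow> real)"
  obtains C where "C \<ge> 0" "\<And>x y. \<bar>g x - g y\<bar> \<le> C * dist x y"
  using assms unfolding lip_def lipschitz_on_def by (auto simp: dist_real_def)

lemma lipI:
  assumes "C \<ge> 0" "\<And>x y. \<bar>g x - g y :: real\<bar> \<le> C * dist x y"
  shows "lip g"
  unfolding lip_def using assms by (intro exI[of _ C] lipschitz_onI) (auto simp: dist_real_def)

lemma lip_measurable: "lip (g :: 'a::metric_space \<Rightarrow> real) \<Longrightarrow> g \<in> borel_measurable borel"
  unfolding lip_def
  by (auto intro!: borel_measurable_continuous_onI dest: lipschitz_on_continuous_on)

lemma lip_upd: "lip g \<Longrightarrow> lip (\<lambda>\<xi>. g (upd \<xi> k s) :: real)"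
proof (elim lipE)
  fix C assume C: "C \<ge> 0" "\<And>x y. \<bar>g x - g y\<bar> \<le> C * dist x y"
  show "lip (\<lambda>\<xi>. g (upd \<xi> k s))"
    by (rule lipI[OF C(1)]) (meson C dist_upd_le mult_left_mono order_trans)
qed

lemma upd_measurable_snd:
  "g \<in> borel_measurable borel \<Longrightarrow> (\<lambda>s. g (upd \<xi> k s)) \<in> borel_measurable borel"
  by (rule measurable_compose[of _ borel borel]) (auto intro!: borel_measurable_vec_lambda)

section \<open>Integrability of Lipschitz functions and the projections
  \<open>P\<^sub>k\<close>\<close>

context product_density
begin

lemma integrable_nth_sq: "integrable M (\<lambda>\<xi>. (\<xi> $ k)\<^sup>2)"
  using second_moment by (simp add: M_def)

lemma integrable_nth: "integrable M (\<lambda>\<xi>. \<xi> $ k)"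
  by (rule M.square_integrable_imp_integrable[OF _ integrable_nth_sq]) simp

lemma integrable_N: "integrable (N k) (\<lambda>s. s)"
  unfolding distr_nth[symmetric] by (subst integrable_distr_eq) (simp_all add: integrable_nth)

text \<open>A Lipschitz function grows at most linearly, so its square is dominated by a constant
  plus a multiple of the squared norm, which the finite second moments make integrable.\<close>

lemma lip_sq_integrable:
  assumes "lip g" shows "integrable M (\<lambda>\<xi>. (g \<xi>)\<^sup>2 :: real)"
proof -
  have [measurable]: "g \<in> borel_measurable borel" using assms by (rule lip_measurable)
  obtain C where C: "C \<ge> 0" "\<And>x y. \<bar>g x - g y\<bar> \<le> C * dist x y"
    using lipE[OF assms] by blast
  have norm: "(norm \<xi>)\<^sup>2 = (\<Sum>i\<in>UNIV. (\<xi> $ i)\<^sup>2)" for \<xi> :: "real^'d::_"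
    by (simp add: norm_vec_def L2_set_def sum_nonneg)
  have "integrable M (\<lambda>\<xi>. 2 * (g 0)\<^sup>2 + 2 * C\<^sup>2 * (\<Sum>i\<in>UNIV. (\<xi> $ i)\<^sup>2))"
    by (intro Bochner_Integration.integrable_add integrable_mult_right
        Bochner_Integration.integrable_sum integrable_nth_sq) simp
  then show ?thesis
  proof (rule Bochner_Integration.integrable_bound)
    have "(g \<xi>)\<^sup>2 \<le> 2 * (g 0)\<^sup>2 + 2 * C\<^sup>2 * (norm \<xi>)\<^sup>2" for \<xi>
    proof -
      have "\<bar>g \<xi>\<bar> \<le> \<bar>g 0\<bar> + C * norm \<xi>" using C(2)[of \<xi> 0] by simp
      then have "(g \<xi>)\<^sup>2 \<le> (\<bar>g 0\<bar> + C * norm \<xi>)\<^sup>2"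
        using abs_le_square_iff by fastforce
      also have "\<dots> \<le> 2 * (g 0)\<^sup>2 + 2 * C\<^sup>2 * (norm \<xi>)\<^sup>2"
        using sum_squares_bound[of "\<bar>g 0\<bar>" "C * norm \<xi>"]
        by (simp add: power2_sum power_mult_distrib)
      finally show ?thesis .
    qed
    then show "AE \<xi> in M. norm ((g \<xi>)\<^sup>2) \<le> norm (2 * (g 0)\<^sup>2 + 2 * C\<^sup>2 * (\<Sum>i\<in>UNIV. (\<xi> $ i)\<^sup>2))"
      by (intro AE_I2) (smt (verit) norm real_norm_def zero_le_power2)
  qed measurable
qed

lemma lip_mult_integrable:
  assumes "lip g" "lip h" shows "integrable M (\<lambda>\<xi>. g \<xi> * h \<xi> :: real)"
proof -
  have [measurable]: "g \<in> borel_measurable borel" "h \<in> borel_measurable borel"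
    using assms by (auto intro: lip_measurable)
  have "integrable M (\<lambda>\<xi>. (g \<xi>)\<^sup>2 + (h \<xi>)\<^sup>2)"
    using assms by (intro Bochner_Integration.integrable_add lip_sq_integrable)
  then show ?thesis
  proof (rule Bochner_Integration.integrable_bound)
    have "\<bar>a * b\<bar> \<le> a\<^sup>2 + b\<^sup>2" for a b :: real
      using sum_squares_bound[of "\<bar>a\<bar>" "\<bar>b\<bar>"] mult_nonneg_nonneg[of "\<bar>a\<bar>" "\<bar>b\<bar>"]
      unfolding abs_mult power2_abs by linarith
    then show "AE \<xi> in M. norm (g \<xi> * h \<xi>) \<le> norm ((g \<xi>)\<^sup>2 + (h \<xi>)\<^sup>2)"
      by simp
  qed measurable
qed

lemma proj_eq:
  assumes "g \<in> borel_measurable borel"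
  shows "proj \<rho> k g \<xi> = (\<integral>s. g (upd \<xi> k s) \<partial>N k)"
proof -
  have [measurable]: "(\<lambda>s. g (upd \<xi> k s)) \<in> borel_measurable borel"
    using assms by (rule upd_measurable_snd)
  show ?thesis
    by (simp add: proj_def N_def integral_density upd_def[symmetric] mult.commute)
qed

text \<open>Growth along a coordinate line is at most linear and \<open>N k\<close> has a first
  moment. Integrability holds on every such line, not just almost every one, which is what permits
  pointwise identities for \<open>P\<^sub>k\<close>.\<close>

lemma integrable_upd:
  assumes "lip g" shows "integrable (N k) (\<lambda>s. g (upd \<xi> k s) :: real)"
proof -
  have [measurable]: "(\<lambda>s. g (upd \<xi> k s)) \<in> borel_measurable borel"
    using assms by (intro upd_measurable_snd lip_measurable)
  obtain C where C: "C \<ge> 0" "\<And>x y. \<bar>g x - g y\<bar> \<le> C * dist x y"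
    using lipE[OF assms] by blast
  have "integrable (N k) (\<lambda>s. \<bar>g \<xi>\<bar> + C * \<bar>s - \<xi> $ k\<bar>)"
    by (intro Bochner_Integration.integrable_add integrable_mult_right integrable_abs
        Bochner_Integration.integrable_diff integrable_N) simp_all
  then show ?thesis
  proof (rule Bochner_Integration.integrable_bound)
    have "\<bar>g (upd \<xi> k s)\<bar> \<le> \<bar>g \<xi>\<bar> + C * \<bar>s - \<xi> $ k\<bar>" for s
      using C(2)[of "upd \<xi> k s" \<xi>] by simp
    then show "AE s in N k. norm (g (upd \<xi> k s)) \<le> norm (\<bar>g \<xi>\<bar> + C * \<bar>s - \<xi> $ k\<bar>)"
      by (intro AE_I2) (smt (verit) real_norm_def)
  qed measurable
qed

text \<open>Overwriting the same coordinate in two points does not increase their distance, so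
  averaging over the new value keeps the Lipschitz constant. The class is thus stable under iterated
  projections.\<close>

lemma proj_lip:
  assumes "lip g" shows "lip (proj \<rho> k g)"
proof -
  obtain C where C: "C \<ge> 0" "\<And>x y. \<bar>g x - g y\<bar> \<le> C * dist x y"
    using lipE[OF assms] by blast
  show ?thesis
  proof (rule lipI[OF C(1)])
    fix \<xi> \<eta> :: "real^'d::_"
    have "\<bar>proj \<rho> k g \<xi> - proj \<rho> k g \<eta>\<bar> = \<bar>\<integral>s. g (upd \<xi> k s) - g (upd \<eta> k s) \<partial>N k\<bar>"
      using assms by (simp add: proj_eq lip_measurable integrable_upd)
    also have "\<dots> \<le> (\<integral>s. \<bar>g (upd \<xi> k s) - g (upd \<eta> k s)\<bar> \<partial>N k)"
      by (rule integral_abs_bound)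
    also have "\<dots> \<le> (\<integral>s. C * dist \<xi> \<eta> \<partial>N k)"
    proof (rule integral_mono)
      show "integrable (N k) (\<lambda>s. \<bar>g (upd \<xi> k s) - g (upd \<eta> k s)\<bar>)"
        using assms by (simp add: integrable_upd)
      show "\<bar>g (upd \<xi> k s) - g (upd \<eta> k s)\<bar> \<le> C * dist \<xi> \<eta>" for s
        by (meson C dist_upd_le mult_left_mono order_trans)
    qed simp
    also have "\<dots> = C * dist \<xi> \<eta>" using N.M.prob_space by simp
    finally show "\<bar>proj \<rho> k g \<xi> - proj \<rho> k g \<eta>\<bar> \<le> C * dist \<xi> \<eta>" .
  qed
qed

lemma proj_upd [simp]: "proj \<rho> k g (upd \<xi> k s) = proj \<rho> k g \<xi>"
  unfolding proj_def upd_def by (intro Bochner_Integration.integral_cong refl arg_cong2[where f="(*)"] arg_cong[where f=g])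
    (auto simp: vec_eq_iff)

lemma proj_fix:
  assumes "lip g" "\<And>\<xi> s. g (upd \<xi> k s) = g \<xi>"
  shows "proj \<rho> k g = g"
proof -
  show ?thesis
    using assms N.M.prob_space by (simp add: fun_eq_iff proj_eq lip_measurable)
qed

lemma proj_idem: "lip g \<Longrightarrow> proj \<rho> k (proj \<rho> k g) = proj \<rho> k g"
  by (rule proj_fix) (simp_all add: proj_lip)

text \<open>This is Fubini for \<open>N k\<close> and \<open>N j\<close>; the required joint
  integrability again comes from linear growth, now in two coordinates.\<close>

lemma proj_commute:
  assumes "lip g" shows "proj \<rho> j (proj \<rho> k g) = proj \<rho> k (proj \<rho> j g)"
proof (cases "j = k")
  case False
  interpret pair_sigma_finite "N k" "N j" ..
  have [measurable]: "g \<in> borel_measurable borel" using assms by (rule lip_measurable)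
  obtain C where C: "C \<ge> 0" "\<And>x y. \<bar>g x - g y\<bar> \<le> C * dist x y"
    using lipE[OF assms] by blast
  show ?thesis
  proof
    fix \<xi> :: "real^'d::_"
    have m: "(\<lambda>(t, s). g (upd (upd \<xi> j s) k t)) \<in> borel_measurable (N k \<Otimes>\<^sub>M N j)"
      unfolding split_beta'
      by (rule measurable_compose[of _ _ borel])
        (auto intro!: borel_measurable_vec_lambda)
    have "integrable (N k \<Otimes>\<^sub>M N j) (\<lambda>(t, s). g (upd (upd \<xi> j s) k t))"
    proof (rule Bochner_Integration.integrable_bound[OF _ m])
      \<comment> \<open>The first marginal of a product of probability measures is its first factor;
        the second coordinate follows by swapping.\<close>
      have fst: "integrable (N a \<Otimes>\<^sub>M N b) (\<lambda>p. h (fst p))" if "integrable (N a) h" for a b and h :: "real \<Rightarrow> real"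
        using that prob_space.distr_pair_fst[OF prob_space_N, of "N a" b]
        by (intro integrable_distr[OF measurable_fst]) simp
      have snd: "integrable (N k \<Otimes>\<^sub>M N j) (\<lambda>p. h (snd p))" if "integrable (N j) h" for h :: "real \<Rightarrow> real"
        using pair_sigma_finite.integrable_product_swap[OF _ fst[OF that, of k]] sigma_finite_N
        by (simp add: pair_sigma_finite_def split_beta')
      show "integrable (N k \<Otimes>\<^sub>M N j) (\<lambda>p. \<bar>g \<xi>\<bar> + C * \<bar>snd p - \<xi> $ j\<bar> + C * \<bar>fst p - \<xi> $ k\<bar>)"
        by (intro Bochner_Integration.integrable_add fst snd integrable_mult_right integrable_abs
            Bochner_Integration.integrable_diff integrable_N fst[of _ "\<lambda>t. C * \<bar>t - \<xi> $ k\<bar>"]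
            snd[of "\<lambda>s. \<bar>g \<xi>\<bar> + C * \<bar>s - \<xi> $ j\<bar>"]) simp_all
      \<comment> \<open>Go from \<open>\<xi>\<close> to the new point by changing coordinate
        \<open>j\<close>, then \<open>k\<close>; as \<open>j\<close> and \<open>k\<close> differ,
        the second move still starts at \<open>\<xi> $ k\<close>.\<close>
      have "\<bar>g (upd (upd \<xi> j s) k t)\<bar> \<le> \<bar>g \<xi>\<bar> + C * \<bar>s - \<xi> $ j\<bar> + C * \<bar>t - \<xi> $ k\<bar>" for s t
        using C(2)[of "upd (upd \<xi> j s) k t" "upd \<xi> j s"] C(2)[of "upd \<xi> j s" \<xi>] False by simp
      then show "AE p in N k \<Otimes>\<^sub>M N j. norm (case p of (t, s) \<Rightarrow> g (upd (upd \<xi> j s) k t))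
          \<le> norm (\<bar>g \<xi>\<bar> + C * \<bar>snd p - \<xi> $ j\<bar> + C * \<bar>fst p - \<xi> $ k\<bar>)"
        by (intro AE_I2) (auto simp: split_beta' intro: order_trans[OF _ abs_ge_self])
    qed
    from Fubini_integral[OF this]
    show "proj \<rho> j (proj \<rho> k g) \<xi> = proj \<rho> k (proj \<rho> j g) \<xi>"
      using False by (simp add: proj_eq lip_measurable proj_lip assms upd_commute)
  qed
qed simp

text \<open>Fubini turns the iterated integral into one over the resampled vector, whose law is
  \<open>M\<close>. Integrability is the hypothesis, rather than \<open>lip\<close>, because the
  application is to products of Lipschitz functions.\<close>

lemma integral_upd:
  assumes "integrable M g"
  shows "(\<integral>\<xi>. (\<integral>s. g (upd \<xi> k s) \<partial>N k) \<partial>M) = (\<integral>\<xi>. g \<xi> \<partial>M :: real)"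
proof -
  interpret pair_sigma_finite M "N k" ..
  have [measurable]: "g \<in> borel_measurable borel" using assms by auto
  have "integrable (M \<Otimes>\<^sub>M N k) (\<lambda>p. g (case p of (\<xi>, s) \<Rightarrow> upd \<xi> k s))"
    using assms by (subst (asm) distr_upd[symmetric, of k], subst (asm) integrable_distr_eq) auto
  then have "integrable (M \<Otimes>\<^sub>M N k) (\<lambda>(\<xi>, s). g (upd \<xi> k s))"
    by (simp add: split_beta')
  then have "(\<integral>\<xi>. (\<integral>s. g (upd \<xi> k s) \<partial>N k) \<partial>M) = (\<integral>(\<xi>, s). g (upd \<xi> k s) \<partial>(M \<Otimes>\<^sub>M N k))"
    by (rule integral_fst)
  also have "\<dots> = integral\<^sup>L (distr (M \<Otimes>\<^sub>M N k) borel (\<lambda>(\<xi>, s). upd \<xi> k s)) g"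
    by (subst integral_distr) (auto simp: split_beta')
  finally show ?thesis by (simp add: distr_upd)
qed

section \<open>The inner product and self-adjointness of the projections\<close>

definition ip :: "(real^'d::_ \<Rightarrow> real) \<Rightarrow> (real^'d::_ \<Rightarrow> real) \<Rightarrow> real" where
  "ip g h = (\<integral>\<xi>. g \<xi> * h \<xi> \<partial>M)"

lemma ip_commute: "ip g h = ip h g"
  by (simp add: ip_def mult.commute)

lemma ip_self_nonneg: "0 \<le> ip g g"
  by (simp add: ip_def)

text \<open>Average over the \<open>k\<close>-th coordinate first: \<open>proj \<rho> k h\<close>
  does not depend on it and leaves the inner integral, where \<open>proj \<rho> k g\<close>
  remains.\<close>

lemma ip_proj_both:
  assumes "lip g" "lip h" shows "ip g (proj \<rho> k h) = ip (proj \<rho> k g) (proj \<rho> k h)"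
proof -
  have "ip g (proj \<rho> k h) = (\<integral>\<xi>. (\<integral>s. g (upd \<xi> k s) * proj \<rho> k h (upd \<xi> k s) \<partial>N k) \<partial>M)"
    unfolding ip_def by (rule integral_upd[symmetric]) (intro lip_mult_integrable assms proj_lip)
  also have "\<dots> = ip (proj \<rho> k g) (proj \<rho> k h)"
    using assms by (simp add: ip_def proj_eq[of g] lip_measurable integrable_upd)
  finally show ?thesis .
qed

text \<open>Both sides equal the symmetric expression
  \<open>ip (proj \<rho> k g) (proj \<rho> k h)\<close>.\<close>

lemma ip_proj_swap:
  assumes "lip g" "lip h" shows "ip g (proj \<rho> k h) = ip (proj \<rho> k g) h"
  using ip_proj_both[OF assms, of k] ip_proj_both[OF assms(2,1), of k] by (simp add: ip_commute)

lemma ip_pythagoras: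
  assumes "lip g" "lip h" "ip g h = 0"
  shows "ip g g + ip h h = ip (\<lambda>\<xi>. g \<xi> + h \<xi>) (\<lambda>\<xi>. g \<xi> + h \<xi>)"
proof -
  have "ip (\<lambda>\<xi>. g \<xi> + h \<xi>) (\<lambda>\<xi>. g \<xi> + h \<xi>) = (\<integral>\<xi>. g \<xi> * g \<xi> + (2 * (g \<xi> * h \<xi>) + h \<xi> * h \<xi>) \<partial>M)"
    unfolding ip_def by (rule arg_cong[where f="integral\<^sup>L M"]) (simp add: fun_eq_iff algebra_simps)
  also have "\<dots> = ip g g + (2 * ip g h + ip h h)"
    using assms by (simp add: ip_def lip_mult_integrable)
  finally show ?thesis using assms by simp
qed

lemma ip_sum_left:
  "(\<And>v. v \<in> A \<Longrightarrow> lip (G v)) \<Longrightarrow> lip h \<Longrightarrow> ip (\<lambda>\<xi>. \<Sum>v\<in>A. G v \<xi>) h = (\<Sum>v\<in>A. ip (G v) h)"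
  by (simp add: ip_def sum_distrib_right lip_mult_integrable Bochner_Integration.integral_sum)

lemma proj_diff: "lip g \<Longrightarrow> lip h \<Longrightarrow> proj \<rho> k (\<lambda>\<xi>. g \<xi> - h \<xi>) = (\<lambda>\<xi>. proj \<rho> k g \<xi> - proj \<rho> k h \<xi>)"
  by (simp add: fun_eq_iff proj_eq lip_measurable lip_diff integrable_upd)

lemma proj_cmult: "lip g \<Longrightarrow> proj \<rho> k (\<lambda>\<xi>. c * g \<xi>) = (\<lambda>\<xi>. c * proj \<rho> k g \<xi>)"
  by (simp add: fun_eq_iff proj_eq lip_measurable lip_cmult)

lemma proj_sum:
  "(\<And>v. v \<in> A \<Longrightarrow> lip (G v)) \<Longrightarrow> proj \<rho> k (\<lambda>\<xi>. \<Sum>v\<in>A. G v \<xi>) = (\<lambda>\<xi>. \<Sum>v\<in>A. proj \<rho> k (G v) \<xi>)"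
  by (simp add: fun_eq_iff proj_eq lip_measurable lip_sum integrable_upd Bochner_Integration.integral_sum)

lemma sq_norm_eq: "lip g \<Longrightarrow> sq_norm \<rho> g = ip g g"
  unfolding sq_norm_def ip_def M_def
  by (subst integral_density) (auto dest: lip_measurable simp: power2_eq_square mult.commute)

section \<open>Composed projections and the ANOVA decomposition\<close>

lemma foldr_proj_lip: "lip f \<Longrightarrow> lip (foldr (proj \<rho>) ks f)"
  by (induction ks) (simp_all add: proj_lip)

text \<open>Commutation moves the new factor from its sorted position to the front, which frees
  \<open>proj_set\<close> from the fixed order in its definition.\<close>

lemma proj_foldr_insort:
  "lip f \<Longrightarrow> foldr (proj \<rho>) (insort k ks) f = proj \<rho> k (foldr (proj \<rho>) ks f)"
  by (induction ks) (simp_all add: foldr_proj_lip proj_commute[of _ k])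

lemma proj_set_lip: "lip f \<Longrightarrow> lip (proj_set \<rho> u f)"
  by (simp add: proj_set_def foldr_proj_lip)

lemma proj_set_insert:
  assumes "lip f" "k \<notin> u" shows "proj_set \<rho> (insert k u) f = proj \<rho> k (proj_set \<rho> u f)"
  using assms by (simp add: proj_set_def proj_foldr_insort)

lemma proj_proj_set:
  assumes "lip f" "k \<in> u" shows "proj \<rho> k (proj_set \<rho> u f) = proj_set \<rho> u f"
proof -
  have "u = insert k (u - {k})" using assms by auto
  then have "proj_set \<rho> u f = proj \<rho> k (proj_set \<rho> (u - {k}) f)"
    using proj_set_insert[OF assms(1), of k "u - {k}"] by simp
  then show ?thesis
    by (simp add: proj_idem proj_set_lip assms)
qed

lemma anova_term_eq:
  "anova_term \<rho> f u = (\<lambda>\<xi>. \<Sum>v\<in>Pow u. (-1) ^ (card u - card v) * proj_set \<rho> (- v) f \<xi>)"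
  by (simp add: fun_eq_iff anova_term_def)

lemma anova_term_lip: "lip f \<Longrightarrow> lip (anova_term \<rho> f u)"
  unfolding anova_term_eq by (intro lip_sum lip_cmult proj_set_lip)

text \<open>If \<open>k\<close> is outside \<open>u\<close>, every \<open>- v\<close> contains
  \<open>k\<close> and each summand is already fixed. If \<open>k\<close> is in \<open>u\<close>,
  the subsets of \<open>u\<close> fall into pairs \<open>v\<close>, \<open>insert k v\<close>;
  \<open>P\<^sub>k\<close> sends both of their projections of \<open>f\<close> to
  \<open>proj_set \<rho> (- v) f\<close>, and the signs are opposite.\<close>

lemma proj_anova_term:
  assumes "lip f"
  shows "proj \<rho> k (anova_term \<rho> f u) = (\<lambda>\<xi>. if k \<in> u then 0 else anova_term \<rho> f u \<xi>)"
proof -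
  have "proj \<rho> k (anova_term \<rho> f u) =
      (\<lambda>\<xi>. \<Sum>v\<in>Pow u. (-1) ^ (card u - card v) * proj \<rho> k (proj_set \<rho> (- v) f) \<xi>)"
    unfolding anova_term_eq using assms
    by (subst proj_sum) (auto intro!: lip_cmult proj_set_lip simp: proj_cmult proj_set_lip)
  also have "\<dots> = (\<lambda>\<xi>. if k \<in> u then 0 else anova_term \<rho> f u \<xi>)"
  proof (cases "k \<in> u")
    case False
    have "proj \<rho> k (proj_set \<rho> (- v) f) = proj_set \<rho> (- v) f" if "v \<subseteq> u" for v
      using that False assms by (intro proj_proj_set) auto
    then show ?thesis
      using False by (auto simp: anova_term_eq)
  next
    case True
    define w where "w = u - {k}"
    have u: "u = insert k w" "k \<notin> w" using True by (auto simp: w_def)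
    have "(\<Sum>v\<in>Pow u. (-1) ^ (card u - card v) * proj \<rho> k (proj_set \<rho> (- v) f) \<xi>) = 0" for \<xi>
    proof -
      have "(\<Sum>v\<in>insert k ` Pow w. (-1) ^ (card u - card v) * proj \<rho> k (proj_set \<rho> (- v) f) \<xi>)
        = (\<Sum>v\<in>Pow w. (-1) ^ (card u - card (insert k v)) * proj \<rho> k (proj_set \<rho> (- insert k v) f) \<xi>)"
        by (rule sum.reindex_cong[where l="insert k"]) (use u in \<open>auto simp: inj_on_def\<close>)
      also have "\<dots> = (\<Sum>v\<in>Pow w. - ((-1) ^ (card u - card v) * proj \<rho> k (proj_set \<rho> (- v) f) \<xi>))"
      proof (rule sum.cong[OF refl])
        fix v assume v: "v \<in> Pow w"
        then have kv: "k \<notin> v" using u by auto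
        \<comment> \<open>\<open>insert k v\<close> is a subset of \<open>u\<close>, so neither
          subtraction truncates and the exponents differ by exactly one.\<close>
        have c: "card u - card v = Suc (card u - card (insert k v))"
          using card_mono[of w v] v kv u by simp
        have "- v = insert k (- insert k v)" using kv by auto
        then have "proj_set \<rho> (- v) f = proj \<rho> k (proj_set \<rho> (- insert k v) f)"
          using proj_set_insert[OF assms, of k "- insert k v"] by simp
        moreover have "proj \<rho> k (proj_set \<rho> (- v) f) = proj_set \<rho> (- v) f"
          using kv assms by (simp add: proj_proj_set)
        ultimately show "(-1) ^ (card u - card (insert k v)) * proj \<rho> k (proj_set \<rho> (- insert k v) f) \<xi>
          = - ((-1) ^ (card u - card v) * proj \<rho> k (proj_set \<rho> (- v) f) \<xi>)"
          by (simp add: c)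
      qed
      finally show ?thesis
        unfolding u(1) Pow_insert using u(2)
        by (subst sum.union_disjoint) (auto simp: sum_negf u(1))
    qed
    then show ?thesis using True by simp
  qed
  finally show ?thesis .
qed

text \<open>Some \<open>k\<close> lies in exactly one of the two sets. \<open>P\<^sub>k\<close>
  fixes one term and annihilates the other, and it may be moved across the inner product.\<close>

lemma ip_anova_term_distinct:
  assumes f: "lip f" and "u \<noteq> w" shows "ip (anova_term \<rho> f u) (anova_term \<rho> f w) = 0"
proof -
  have *: "ip (anova_term \<rho> f u) (anova_term \<rho> f w) = 0" if "k \<in> u" "k \<notin> w" for k u w
  proof -
    have "ip (anova_term \<rho> f u) (anova_term \<rho> f w) = ip (anova_term \<rho> f u) (proj \<rho> k (anova_term \<rho> f w))"
      using that by (simp add: proj_anova_term f)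
    also have "\<dots> = ip (proj \<rho> k (anova_term \<rho> f u)) (anova_term \<rho> f w)"
      by (intro ip_proj_swap anova_term_lip f)
    also have "\<dots> = 0" using that by (simp add: proj_anova_term f ip_def)
    finally show ?thesis .
  qed
  from \<open>u \<noteq> w\<close> obtain k where "k \<in> u \<and> k \<notin> w \<or> k \<in> w \<and> k \<notin> u" by auto
  then show ?thesis using *[of k u w] *[of k w u] by (auto simp: ip_commute)
qed

text \<open>Moebius inversion on the subset lattice, evaluated at the full set, where no variable is
  integrated out.\<close>

lemma sum_anova_term: "(\<Sum>u\<in>UNIV. anova_term \<rho> f u \<xi>) = f \<xi>"
proof -
  have "f \<xi> = proj_set \<rho> (- UNIV) f \<xi>"
    by (simp add: proj_set_def)
  also have "\<dots> = (\<Sum>u\<in>Pow UNIV. (-1) ^ card u * (\<Sum>v\<in>Pow u. (-1) ^ card v * proj_set \<rho> (- v) f \<xi>))"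
    by (rule inclusion_exclusion_symmetric[where f="\<lambda>v. proj_set \<rho> (- v) f \<xi>"]) simp_all
  also have "\<dots> = (\<Sum>u\<in>UNIV. anova_term \<rho> f u \<xi>)"
  proof -
    \<comment> \<open>Inclusion-exclusion produces the sign with exponent
      \<open>card u + card v\<close>, which has the parity of the difference.\<close>
    have "(-1) ^ card u * ((-1) ^ card v * (c::real)) = (-1) ^ (card u - card v) * c"
      if "v \<subseteq> u" for u v :: "'d set" and c
    proof -
      have "card v \<le> card u" using that by (simp add: card_mono)
      then show ?thesis
        by (simp flip: neg_one_power_add_eq_neg_one_power_diff add: power_add)
    qed
    then show ?thesis
      unfolding anova_term_def sum_distrib_left by (auto intro!: sum.cong)
  qed
  finally show ?thesis by simp
qed

text \<open>Applying \<open>P\<^sub>k\<close> to the full decomposition deletes exactly the terms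
  with \<open>k\<close> in \<open>u\<close>.\<close>

lemma sum_anova_term_containing:
  assumes f: "lip f"
  shows "(\<Sum>u | k \<in> u. anova_term \<rho> f u \<xi>) = f \<xi> - proj \<rho> k f \<xi>"
proof -
  have "proj \<rho> k f \<xi> = proj \<rho> k (\<lambda>\<xi>. \<Sum>u\<in>UNIV. anova_term \<rho> f u \<xi>) \<xi>"
    by (simp add: sum_anova_term)
  also have "\<dots> = (\<Sum>u\<in>UNIV. if k \<in> u then 0 else anova_term \<rho> f u \<xi>)"
    using f by (simp add: proj_sum anova_term_lip proj_anova_term)
  also have "\<dots> = (\<Sum>u\<in>UNIV. anova_term \<rho> f u \<xi>) - (\<Sum>u\<in>UNIV. if k \<in> u then anova_term \<rho> f u \<xi> else 0)"
    unfolding sum_subtractf[symmetric] by (auto intro: sum.cong)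
  finally show ?thesis
    by (simp add: sum_anova_term sum.If_cases)
qed

text \<open>Parseval's identity for the orthogonal expansion of \<open>f - P\<^sub>k f\<close>:
  pairing it with one of its terms leaves only the square of that term.\<close>

lemma sum_sigma2_term_containing:
  assumes f: "lip f"
  shows "(\<Sum>u | k \<in> u. sigma2_term \<rho> f u) = sq_norm \<rho> (\<lambda>\<xi>. f \<xi> - proj \<rho> k f \<xi>)"
proof -
  let ?g = "\<lambda>\<xi>. f \<xi> - proj \<rho> k f \<xi>"
  have g: "lip ?g" using f by (intro lip_diff proj_lip)
  have "ip ?g ?g = ip (\<lambda>\<xi>. \<Sum>u | k \<in> u. anova_term \<rho> f u \<xi>) ?g"
    using f by (simp add: sum_anova_term_containing)
  also have "\<dots> = (\<Sum>u | k \<in> u. ip (anova_term \<rho> f u) ?g)"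
    using f g by (intro ip_sum_left anova_term_lip)
  also have "\<dots> = (\<Sum>u | k \<in> u. ip (anova_term \<rho> f u) (anova_term \<rho> f u))"
  proof (rule sum.cong[OF refl])
    fix u assume u: "u \<in> {u. k \<in> u}"
    have "ip (anova_term \<rho> f u) ?g = ip (\<lambda>\<xi>. \<Sum>w | k \<in> w. anova_term \<rho> f w \<xi>) (anova_term \<rho> f u)"
      using f by (simp add: sum_anova_term_containing ip_commute)
    also have "\<dots> = (\<Sum>w | k \<in> w. ip (anova_term \<rho> f w) (anova_term \<rho> f u))"
      using f by (intro ip_sum_left anova_term_lip)
    also have "\<dots> = (\<Sum>w | k \<in> w. if w = u then ip (anova_term \<rho> f u) (anova_term \<rho> f u) else 0)"
      using f by (intro sum.cong refl) (auto simp: ip_anova_term_distinct)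
    also have "\<dots> = ip (anova_term \<rho> f u) (anova_term \<rho> f u)"
      using u by simp
    finally show "ip (anova_term \<rho> f u) ?g = ip (anova_term \<rho> f u) (anova_term \<rho> f u)" .
  qed
  finally show ?thesis
    using f g by (simp add: sq_norm_eq sigma2_term_def anova_term_lip)
qed

text \<open>The best approximation property appears as Pythagoras: \<open>?g\<close> is orthogonal
  to \<open>?h\<close>, and \<open>?g + ?h\<close> is the increment of \<open>f\<close> when the
  \<open>k\<close>-th coordinate is frozen at \<open>m\<close>. The sharp constant \<open>L\<close>
  of that coordinate enters here, whereas \<open>lip\<close> only records that some constant
  exists.\<close>

lemma sq_norm_diff_proj_le:
  assumes f: "lip f" and L: "\<And>\<xi> s. \<bar>f \<xi> - f (upd \<xi> k s)\<bar> \<le> L * \<bar>\<xi> $ k - s\<bar>"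
  shows "sq_norm \<rho> (\<lambda>\<xi>. f \<xi> - proj \<rho> k f \<xi>) \<le> L\<^sup>2 * M.variance (\<lambda>\<xi>. \<xi> $ k)"
proof -
  define m where "m = M.expectation (\<lambda>\<xi>. \<xi> $ k)"
  let ?g = "\<lambda>\<xi>. f \<xi> - proj \<rho> k f \<xi>" and ?h = "\<lambda>\<xi>. proj \<rho> k f \<xi> - f (upd \<xi> k m)"
  have lip: "lip ?g" "lip ?h" "lip (proj \<rho> k f)" "lip (\<lambda>\<xi>. f (upd \<xi> k m))"
    using f by (auto intro!: lip_diff proj_lip lip_upd)
  \<comment> \<open>\<open>?h\<close> is free of the \<open>k\<close>-th coordinate and
    \<open>?g\<close> is annihilated by \<open>P\<^sub>k\<close>, so self-adjointness makes them
    orthogonal.\<close>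
  have "proj \<rho> k ?h = ?h" by (rule proj_fix) (simp_all add: lip)
  moreover have "proj \<rho> k ?g = (\<lambda>_. 0)"
    using f by (simp add: proj_diff proj_lip proj_idem)
  ultimately have "ip ?g ?h = 0"
    using ip_proj_swap[OF lip(1,2), of k] by (simp add: ip_def)
  then have "ip ?g ?g + ip ?h ?h = ip (\<lambda>\<xi>. ?g \<xi> + ?h \<xi>) (\<lambda>\<xi>. ?g \<xi> + ?h \<xi>)"
    by (rule ip_pythagoras[OF lip(1,2)])
  also have "\<dots> \<le> (\<integral>\<xi>. L\<^sup>2 * (\<xi> $ k - m)\<^sup>2 \<partial>M)"
    unfolding ip_def
  proof (rule integral_mono)
    show "integrable M (\<lambda>\<xi>. (?g \<xi> + ?h \<xi>) * (?g \<xi> + ?h \<xi>))"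
      using lip(1,2) by (intro lip_mult_integrable lip_add)
    have "lip (\<lambda>\<xi>. \<xi> $ k - m)"
      by (rule lipI[of 1]) (auto simp: dist_norm simp flip: vector_minus_component intro: component_le_norm_cart)
    then show "integrable M (\<lambda>\<xi>. L\<^sup>2 * (\<xi> $ k - m)\<^sup>2)"
      by (intro integrable_mult_right lip_sq_integrable)
    show "(?g \<xi> + ?h \<xi>) * (?g \<xi> + ?h \<xi>) \<le> L\<^sup>2 * (\<xi> $ k - m)\<^sup>2" for \<xi>
      using power_mono[OF L[of \<xi> m], of 2] by (simp add: power_mult_distrib flip: power2_eq_square)
  qed
  also have "\<dots> = L\<^sup>2 * M.variance (\<lambda>\<xi>. \<xi> $ k)"
    by (simp add: m_def)
  finally show ?thesis
    using lip ip_self_nonneg[of ?h] by (simp add: sq_norm_eq)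
qed

end

section \<open>Lipschitz bounds for the recourse function\<close>

lemma polyhedron_dual_feasible: "polyhedron (dual_feasible W q)"
proof -
  have "dual_feasible W q = \<Inter> (range (\<lambda>j. {z. column j W \<bullet> z \<le> q $ j}))"
    by (auto simp: dual_feasible_def matrix_vector_mult_def transpose_def column_def inner_vec_def)
  then show ?thesis
    by (auto intro!: polyhedron_Inter polyhedron_halfspace_le)
qed

text \<open>Take \<open>v\<close> maximal at \<open>\<xi>\<close>; it is still a candidate at
  \<open>\<eta>\<close>, and the contribution of \<open>T *v x\<close> cancels in the
  difference.\<close>

lemma recourse_value_diff_le:
  assumes "finite V" "V \<noteq> {}"
  obtains v where "v \<in> V"
    "recourse_value V \<iota> hbar T x \<xi> - recourse_value V \<iota> hbar T x \<eta>
      \<le> v \<bullet> (join_vec \<iota> hbar \<xi> - join_vec \<iota> hbar \<eta>)"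
proof -
  let ?F = "\<lambda>\<xi> v. v \<bullet> (join_vec \<iota> hbar \<xi> - T *v x)"
  have "recourse_value V \<iota> hbar T x \<xi> \<in> ?F \<xi> ` V"
    unfolding recourse_value_def using assms by (intro Max_in) auto
  then obtain v where v: "v \<in> V" "recourse_value V \<iota> hbar T x \<xi> = ?F \<xi> v" by auto
  have "?F \<eta> v \<le> recourse_value V \<iota> hbar T x \<eta>"
    unfolding recourse_value_def using assms v by (intro Max_ge) auto
  with v show ?thesis
    by (intro that[of v]) (simp_all add: inner_diff_right)
qed

lemma join_vec_diff_nth:
  "(join_vec \<iota> hbar \<xi> - join_vec \<iota> hbar \<eta>) $ k = (if k \<in> range \<iota> then (\<xi> - \<eta>) $ inv \<iota> k else 0)"
  by (simp add: join_vec_def)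

lemma join_vec_upd:
  assumes "inj \<iota>"
  shows "join_vec \<iota> hbar (upd \<xi> i s) = join_vec \<iota> hbar \<xi> + axis (\<iota> i) (s - \<xi> $ i)"
  using assms by (auto simp: vec_eq_iff join_vec_def axis_def)

lemma recourse_value_lip:
  assumes "finite V" "V \<noteq> {}"
  shows "lip (recourse_value V \<iota> hbar T x)"
proof -
  \<comment> \<open>A crude constant that dominates the absolute entry sum of every single
    \<open>v\<close> in \<open>V\<close>; only its existence matters.\<close>
  define C where "C = (\<Sum>v\<in>V. \<Sum>k\<in>UNIV. \<bar>v $ k\<bar>)"
  have le: "recourse_value V \<iota> hbar T x \<xi> - recourse_value V \<iota> hbar T x \<eta> \<le> C * dist \<xi> \<eta>" for \<xi> \<eta>
  proof -
    obtain v where v: "v \<in> V" "recourse_value V \<iota> hbar T x \<xi> - recourse_value V \<iota> hbar T x \<eta>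
      \<le> v \<bullet> (join_vec \<iota> hbar \<xi> - join_vec \<iota> hbar \<eta>)"
      using recourse_value_diff_le[OF assms] by blast
    note v(2)
    also have "v \<bullet> (join_vec \<iota> hbar \<xi> - join_vec \<iota> hbar \<eta>) \<le> (\<Sum>k\<in>UNIV. \<bar>v $ k\<bar> * dist \<xi> \<eta>)"
      unfolding inner_vec_def
    proof (rule sum_mono)
      fix k
      have "\<bar>(join_vec \<iota> hbar \<xi> - join_vec \<iota> hbar \<eta>) $ k\<bar> \<le> dist \<xi> \<eta>"
        unfolding join_vec_diff_nth dist_norm using component_le_norm_cart[of "\<xi> - \<eta>"] by simp
      then have "\<bar>v $ k\<bar> * \<bar>(join_vec \<iota> hbar \<xi> - join_vec \<iota> hbar \<eta>) $ k\<bar> \<le> \<bar>v $ k\<bar> * dist \<xi> \<eta>"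
        by (rule mult_left_mono) simp
      then show "v $ k \<bullet> (join_vec \<iota> hbar \<xi> - join_vec \<iota> hbar \<eta>) $ k \<le> \<bar>v $ k\<bar> * dist \<xi> \<eta>"
        unfolding abs_mult[symmetric] inner_real_def by linarith
    qed
    also have "\<dots> \<le> C * dist \<xi> \<eta>"
      unfolding C_def sum_distrib_right[symmetric]
      by (intro mult_right_mono member_le_sum[of v V "\<lambda>v. \<Sum>k\<in>UNIV. \<bar>v $ k\<bar>"])
        (simp_all add: v assms sum_nonneg)
    finally show ?thesis .
  qed
  show ?thesis
  proof (rule lipI)
    show "0 \<le> C" by (simp add: C_def sum_nonneg)
    show "\<bar>recourse_value V \<iota> hbar T x \<xi> - recourse_value V \<iota> hbar T x \<eta>\<bar> \<le> C * dist \<xi> \<eta>" for \<xi> \<eta>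
      using le[of \<xi> \<eta>] le[of \<eta> \<xi>] by (simp add: dist_commute)
  qed
qed

text \<open>The increment of the right-hand side is a multiple of one axis vector, so a vertex
  contributes only its component \<open>\<iota> i\<close>. The maximizers at the two points may
  differ, hence one vertex for each direction.\<close>

lemma recourse_value_upd_le:
  assumes "finite V" "V \<noteq> {}" "inj \<iota>" and L: "\<And>v. v \<in> V \<Longrightarrow> \<bar>v $ \<iota> i\<bar> \<le> L"
  shows "\<bar>recourse_value V \<iota> hbar T x \<xi> - recourse_value V \<iota> hbar T x (upd \<xi> i s)\<bar> \<le> L * \<bar>\<xi> $ i - s\<bar>"
proof -
  let ?f = "recourse_value V \<iota> hbar T x" and ?j = "join_vec \<iota> hbar"
  have bound: "v \<bullet> axis (\<iota> i) c \<le> L * \<bar>c\<bar>" if "v \<in> V" for v c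
  proof -
    have "\<bar>v $ \<iota> i\<bar> * \<bar>c\<bar> \<le> L * \<bar>c\<bar>" by (intro mult_right_mono L that) simp
    then show ?thesis unfolding inner_axis abs_mult[symmetric] inner_real_def by linarith
  qed
  have up: "?j (upd \<xi> i s) - ?j \<xi> = axis (\<iota> i) (s - \<xi> $ i)" and
    down: "?j \<xi> - ?j (upd \<xi> i s) = axis (\<iota> i) (\<xi> $ i - s)"
    using assms(3) by (simp_all add: join_vec_upd vec_eq_iff axis_def)
  obtain v where "v \<in> V" "?f \<xi> - ?f (upd \<xi> i s) \<le> v \<bullet> (?j \<xi> - ?j (upd \<xi> i s))"
    using recourse_value_diff_le[OF assms(1,2)] by blast
  moreover obtain w where "w \<in> V" "?f (upd \<xi> i s) - ?f \<xi> \<le> w \<bullet> (?j (upd \<xi> i s) - ?j \<xi>)"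
    using recourse_value_diff_le[OF assms(1,2)] by blast
  ultimately show ?thesis
    using bound[of v "\<xi> $ i - s"] bound[of w "s - \<xi> $ i"] unfolding up down
    by (simp add: abs_minus_commute)
qed

section \<open>Mean dimension as a sum of sensitivity indices, and the final bounds\<close>

lemma mean_dim_superposition_eq:
  "mean_dim_superposition \<rho> f = (\<Sum>i\<in>UNIV. global_sensitivity \<rho> f {i})"
proof -
  have sets: "{u. u \<inter> {i} \<noteq> {}} = {u. i \<in> u}" for i :: 'a by auto
  \<comment> \<open>The empty set may be included because its cardinality factor is zero.\<close>
  have "mean_dim_superposition \<rho> f = (\<Sum>u\<in>UNIV. real (card u) * (sigma2_term \<rho> f u / sigma2 \<rho> f))"
    unfolding mean_dim_superposition_def by (rule sum.mono_neutral_left) auto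
  also have "\<dots> = (\<Sum>u\<in>UNIV. \<Sum>i\<in>UNIV. if i \<in> u then sigma2_term \<rho> f u / sigma2 \<rho> f else 0)"
    by (simp add: sum.If_cases)
  also have "\<dots> = (\<Sum>i\<in>UNIV. \<Sum>u\<in>UNIV. if i \<in> u then sigma2_term \<rho> f u / sigma2 \<rho> f else 0)"
    by (rule sum.swap)
  also have "\<dots> = (\<Sum>i\<in>UNIV. global_sensitivity \<rho> f {i})"
    unfolding global_sensitivity_def sets by (simp add: sum.If_cases sum_divide_distrib)
  finally show ?thesis .
qed

theorem proposition7p1:
  fixes X :: "(real^'m) set" and T :: "real^'m^'r" and W :: "real^'n^'r" and q :: "real^'n"
    and \<iota> :: "'d::{finite,linorder} \<Rightarrow> 'r" and hbar :: "'r \<Rightarrow> real"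
    and P :: "(real^'d::_) measure" and \<rho> :: "'d \<Rightarrow> real \<Rightarrow> real"
    and x :: "real^'m" and V :: "(real^'r) set" and f :: "real^'d::_ \<Rightarrow> real"
    and \<sigma>sq :: "'d \<Rightarrow> real"
  assumes X: "polyhedron X"
    and \<iota>: "inj \<iota>"
    and P: "prob_space P"
    and V: "V = vertices (dual_feasible W q)"
    and decomposition: "dual_feasible W q =
          {a + b | a b. a \<in> convex hull V \<and> b \<in> {z. \<forall>j. (transpose W *v z) $ j \<le> 0}}"
    and A1: "\<forall>\<xi>. \<forall>y\<in>X. join_vec \<iota> hbar \<xi> - T *v y \<in> (\<lambda>w. W *v w) ` {w. \<forall>j. 0 \<le> w $ j}"
    and A2: "dual_feasible W q \<noteq> {}"
    and A3: "integrable P norm"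
    and A4: "P = density lborel (\<lambda>\<xi>. ennreal (joint_density \<rho> \<xi>))"
            "\<forall>i. continuous_on UNIV (\<rho> i) \<and> (\<forall>s. 0 \<le> \<rho> i s) \<and> has_bochner_integral lborel (\<rho> i) 1"
    and finite_variance: "\<forall>i. integrable P (\<lambda>\<xi>. (\<xi> $ i)\<^sup>2)"
    and \<sigma>sq: "\<forall>i. \<sigma>sq i = prob_space.variance P (\<lambda>\<xi>. \<xi> $ i)"
    and x: "x \<in> X"
    and f: "f = recourse_value V \<iota> hbar T x"
    and pos: "sigma2 \<rho> f > 0"
  shows "(\<forall>i. global_sensitivity \<rho> f {i} \<le> \<sigma>sq i / sigma2 \<rho> f * (MAX v\<in>V. \<bar>v $ \<iota> i\<bar>\<^sup>2)) \<and>
         mean_dim_superposition \<rho> f \<le>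
           1 / sigma2 \<rho> f * (MAX v\<in>V. (infnorm v)\<^sup>2) * (\<Sum>i\<in>UNIV. \<sigma>sq i)"
proof -
  interpret product_density \<rho>
  proof
    fix i s
    show "\<rho> i \<in> borel_measurable borel"
      using A4(2) by (auto intro: borel_measurable_continuous_onI)
    show "0 \<le> \<rho> i s" using A4(2) by blast
    show "(\<integral>\<^sup>+s. ennreal (\<rho> i s) \<partial>lborel) = 1"
      using A4(2) nn_integral_eq_integral[of lborel "\<rho> i"]
      by (auto simp: has_bochner_integral_iff)
    show "integrable (density lborel (\<lambda>\<xi>::real^'d::_. ennreal (joint_density \<rho> \<xi>))) (\<lambda>\<xi>. (\<xi> $ i)\<^sup>2)"
      using finite_variance by (simp add: A4(1))
  qed
  have fin: "finite V"
    unfolding V vertices_def by (intro finite_polyhedron_extreme_points polyhedron_dual_feasible)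
  \<comment> \<open>Without vertices the convex hull, and with it the sum in
    \<open>decomposition\<close>, would be empty, contrary to \<open>A2\<close>.\<close>
  have ne: "V \<noteq> {}"
    using A2 decomposition by auto
  have lip: "lip f"
    unfolding f using fin ne by (rule recourse_value_lip)
  have var: "\<sigma>sq i = M.variance (\<lambda>\<xi>. \<xi> $ i)" for i
    using \<sigma>sq by (simp add: A4(1) M_def)
  have var_nonneg: "0 \<le> \<sigma>sq i" for i
    unfolding var by (rule M.variance_positive)
  \<comment> \<open>Any common bound \<open>B\<close> on the squared components is allowed, with
    Lipschitz constant \<open>sqrt B\<close>; both claims are instances.\<close>
  have sens: "global_sensitivity \<rho> f {i} \<le> \<sigma>sq i / sigma2 \<rho> f * B"
    if B: "\<And>v. v \<in> V \<Longrightarrow> \<bar>v $ \<iota> i\<bar>\<^sup>2 \<le> B" for i B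
  proof -
    obtain v where "v \<in> V" using ne by blast
    then have B0: "0 \<le> B" using B[of v] by (smt (verit) zero_le_power2)
    have sets: "{u. u \<inter> {i} \<noteq> {}} = {u. i \<in> u}" by auto
    have "\<bar>f \<xi> - f (upd \<xi> i s)\<bar> \<le> sqrt B * \<bar>\<xi> $ i - s\<bar>" for \<xi> s
      unfolding f by (rule recourse_value_upd_le[OF fin ne \<iota>]) (rule real_le_rsqrt[OF B])
    then have "sq_norm \<rho> (\<lambda>\<xi>. f \<xi> - proj \<rho> i f \<xi>) \<le> (sqrt B)\<^sup>2 * \<sigma>sq i"
      unfolding var by (rule sq_norm_diff_proj_le[OF lip])
    then have "(\<Sum>u | i \<in> u. sigma2_term \<rho> f u) \<le> B * \<sigma>sq i"
      using B0 by (simp add: sum_sigma2_term_containing[OF lip])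
    then show ?thesis
      using pos unfolding global_sensitivity_def sets by (simp add: field_simps)
  qed
  have "global_sensitivity \<rho> f {i} \<le> \<sigma>sq i / sigma2 \<rho> f * (MAX v\<in>V. \<bar>v $ \<iota> i\<bar>\<^sup>2)" for i
    by (rule sens) (use fin in auto)
  \<comment> \<open>This weaker bound does not depend on \<open>i\<close> and so factors out of the
    sum over \<open>i\<close>.\<close>
  moreover have "global_sensitivity \<rho> f {i} \<le> \<sigma>sq i / sigma2 \<rho> f * (MAX v\<in>V. (infnorm v)\<^sup>2)" for i
  proof (rule sens)
    fix v assume v: "v \<in> V"
    have "\<bar>v $ \<iota> i\<bar>\<^sup>2 \<le> (infnorm v)\<^sup>2"
      by (intro power_mono component_le_infnorm_cart) simp
    also have "\<dots> \<le> (MAX v\<in>V. (infnorm v)\<^sup>2)" using fin v by auto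
    finally show "\<bar>v $ \<iota> i\<bar>\<^sup>2 \<le> (MAX v\<in>V. (infnorm v)\<^sup>2)" .
  qed
  then have "mean_dim_superposition \<rho> f \<le> (\<Sum>i\<in>UNIV. \<sigma>sq i / sigma2 \<rho> f * (MAX v\<in>V. (infnorm v)\<^sup>2))"
    unfolding mean_dim_superposition_eq by (rule sum_mono)
  then have "mean_dim_superposition \<rho> f \<le> 1 / sigma2 \<rho> f * (MAX v\<in>V. (infnorm v)\<^sup>2) * (\<Sum>i\<in>UNIV. \<sigma>sq i)"
    by (simp add: sum_divide_distrib sum_distrib_right mult.commute)
  ultimately show ?thesis by blast
qed

end
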